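(* Let $\mathcal A$ be a reflective subcategory of a wellpowered category $\mathcal X$ with intersections. The subcategory $\mathcal B$ whose objects are the $\mathcal X$-extremal subobjects of $\mathcal A$-objects is the smallest intermediate subcategory of $(\mathcal A,\mathcal X)$ and induces the same regular closure operators as induced by $\mathcal A$ (up to isomorphism), i.e. $c_{\mathcal A}(m)\cong c_{\mathcal B}(m)$ for all $m\in\mathcal M$.
   Context: Subcategories are always full and isomorphism-closed. $\mathcal X$ is a category with a fixed class $\mathcal M$ of morphisms containing all isomorphisms. $\mathcal X$ is $\mathcal M$-complete: $\mathcal M$ is closed under composition; pullbacks of $\mathcal M$-morphisms exist and belong to $\mathcal M$; multiple pullbacks of (possibly large) families of $\mathcal M$-morphisms with common codomain exist and belong to $\mathcal M$. Consequently every morphism in $\mathcal M$ is a monomorphism, and for each object $X$ the class $\mathcal M/X$ of $\mathcal M$-morphisms with codomain $X$ is a (possibly large) complete preordered class ($m\le n$ iff $m = n\cdot k$ for some $k$); $\cong$ denotes equivalence in this preorder. Moreover $\mathcal X$ has equalizers and cokernel pairs, and $\mathcal M$ contains all regular monomorphisms of $\mathcal X$. For a subcategory $\mathcal A$, a morphism is an $\mathcal A$-regular monomorphism if it is the equalizer of two morphisms $h,k : Y\to A$ with $A\in\mathcal A$. The regular closure operator induced by $\mathcal A$ is $c_{\mathcal A}(m)=\bigwedge\{r\in\mathcal M \mid r\ge m,\ r \text{ is } \mathcal A\text{-regular}\}$ for $m \in \mathcal M/X$ (meet in $\mathcal M/X$). A category is wellpowered if the subobjects of every object form a (small) set. An object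 $X$ is an $\mathcal X$-extremal subobject of $A$ if there is an extremal monomorphism $X\to A$ in $\mathcal X$ (a monomorphism $m$ such that $m=f\cdot e$ with $e$ an epimorphism implies $e$ is an isomorphism). Intermediate category: let $\mathbf r$ be a reflector from $\mathcal X$ to $\mathcal A$. If $\mathbf r=\mathbf s\cdot\mathbf t$ where $\mathbf t:\mathcal X\to\mathcal B$ is an $\mathcal X$-epireflector (a reflector whose reflection morphisms are epimorphisms in $\mathcal X$) and $\mathbf s:\mathcal B\to\mathcal A$ is a $\mathcal B$-epireflector (a reflector whose reflection morphisms are epimorphisms in $\mathcal B$), then $\mathcal B$ is said to be an intermediate category (intermediate subcategory) of the pair $(\mathcal A,\mathcal X)$. "Smallest" refers to inclusion of subcategories. *)

theory Defs
  imports "HOL-Library.Equipollence"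
begin

section \<open>Categories\<close>

text \<open>
  Composition is written in the usual order: \<open>g \<cdot> f\<close> is \<open>f\<close> followed by \<open>g\<close>. The sets of objects and
  of morphisms play the role of (possibly large) classes; no local smallness is imposed.
\<close>

record ('o, 'a) category =
  Ob :: "'o set"
  Ar :: "'a set"
  Dom :: "'a \<Rightarrow> 'o"
  Cod :: "'a \<Rightarrow> 'o"
  Idt :: "'o \<Rightarrow> 'a"  ("\<iota>\<index>")
  Comp :: "'a \<Rightarrow> 'a \<Rightarrow> 'a"  (infixl "\<cdot>\<index>" 70)

definition Hom :: "('o, 'a, 'z) category_scheme \<Rightarrow> 'o \<Rightarrow> 'o \<Rightarrow> 'a set" where
  "Hom C x y = {f \<in> Ar C. Dom C f = x \<and> Cod C f = y}"

locale category =
  fixes C :: "('o, 'a, 'z) category_scheme" (structure)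
  assumes Dom_Ob: "f \<in> Ar C \<Longrightarrow> Dom C f \<in> Ob C"
    and Cod_Ob: "f \<in> Ar C \<Longrightarrow> Cod C f \<in> Ob C"
    and Idt_Hom: "x \<in> Ob C \<Longrightarrow> \<iota> x \<in> Hom C x x"
    and Comp_Hom: "\<lbrakk>f \<in> Hom C x y; g \<in> Hom C y z\<rbrakk> \<Longrightarrow> g \<cdot> f \<in> Hom C x z"
    and Comp_Idt: "f \<in> Hom C x y \<Longrightarrow> f \<cdot> \<iota> x = f"
    and Idt_Comp: "f \<in> Hom C x y \<Longrightarrow> \<iota> y \<cdot> f = f"
    and Comp_assoc:
      "\<lbrakk>f \<in> Hom C w x; g \<in> Hom C x y; h \<in> Hom C y z\<rbrakk> \<Longrightarrow> h \<cdot> (g \<cdot> f) = (h \<cdot> g) \<cdot> f"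

definition isomorphism :: "('o, 'a, 'z) category_scheme \<Rightarrow> 'a \<Rightarrow> bool" where
  "isomorphism C f \<longleftrightarrow> f \<in> Ar C \<and>
     (\<exists>g \<in> Hom C (Cod C f) (Dom C f).
        g \<cdot>\<^bsub>C\<^esub> f = \<iota>\<^bsub>C\<^esub> (Dom C f) \<and> f \<cdot>\<^bsub>C\<^esub> g = \<iota>\<^bsub>C\<^esub> (Cod C f))"

definition monic :: "('o, 'a, 'z) category_scheme \<Rightarrow> 'a \<Rightarrow> bool" where
  "monic C m \<longleftrightarrow> m \<in> Ar C \<and>
     (\<forall>z \<in> Ob C. \<forall>f \<in> Hom C z (Dom C m). \<forall>g \<in> Hom C z (Dom C m).
        m \<cdot>\<^bsub>C\<^esub> f = m \<cdot>\<^bsub>C\<^esub> g \<longrightarrow> f = g)"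

definition epi :: "('o, 'a, 'z) category_scheme \<Rightarrow> 'a \<Rightarrow> bool" where
  "epi C e \<longleftrightarrow> e \<in> Ar C \<and>
     (\<forall>z \<in> Ob C. \<forall>f \<in> Hom C (Cod C e) z. \<forall>g \<in> Hom C (Cod C e) z.
        f \<cdot>\<^bsub>C\<^esub> e = g \<cdot>\<^bsub>C\<^esub> e \<longrightarrow> f = g)"

definition extremal_mono :: "('o, 'a, 'z) category_scheme \<Rightarrow> 'a \<Rightarrow> bool" where
  "extremal_mono C m \<longleftrightarrow> monic C m \<and>
     (\<forall>y \<in> Ob C. \<forall>e \<in> Hom C (Dom C m) y. \<forall>f \<in> Hom C y (Cod C m).
        m = f \<cdot>\<^bsub>C\<^esub> e \<and> epi C e \<longrightarrow> isomorphism C e)"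


section \<open>Limits and colimits\<close>

definition equalizer :: "('o, 'a, 'z) category_scheme \<Rightarrow> 'a \<Rightarrow> 'a \<Rightarrow> 'a \<Rightarrow> bool" where
  "equalizer C h k e \<longleftrightarrow>
     h \<in> Ar C \<and> k \<in> Hom C (Dom C h) (Cod C h) \<and>
     e \<in> Ar C \<and> Cod C e = Dom C h \<and> h \<cdot>\<^bsub>C\<^esub> e = k \<cdot>\<^bsub>C\<^esub> e \<and>
     (\<forall>z \<in> Ob C. \<forall>f \<in> Hom C z (Dom C h).
        h \<cdot>\<^bsub>C\<^esub> f = k \<cdot>\<^bsub>C\<^esub> f \<longrightarrow> (\<exists>!g. g \<in> Hom C z (Dom C e) \<and> e \<cdot>\<^bsub>C\<^esub> g = f))"

definition has_equalizers :: "('o, 'a, 'z) category_scheme \<Rightarrow> bool" where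
  "has_equalizers C \<longleftrightarrow>
     (\<forall>h \<in> Ar C. \<forall>k \<in> Hom C (Dom C h) (Cod C h). \<exists>e. equalizer C h k e)"

definition cokernel_pair :: "('o, 'a, 'z) category_scheme \<Rightarrow> 'a \<Rightarrow> 'a \<Rightarrow> 'a \<Rightarrow> bool" where
  "cokernel_pair C f u v \<longleftrightarrow>
     f \<in> Ar C \<and> u \<in> Ar C \<and> Dom C u = Cod C f \<and> v \<in> Hom C (Dom C u) (Cod C u) \<and>
     u \<cdot>\<^bsub>C\<^esub> f = v \<cdot>\<^bsub>C\<^esub> f \<and>
     (\<forall>z \<in> Ob C. \<forall>u' \<in> Hom C (Cod C f) z. \<forall>v' \<in> Hom C (Cod C f) z.
        u' \<cdot>\<^bsub>C\<^esub> f = v' \<cdot>\<^bsub>C\<^esub> f \<longrightarrow>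
        (\<exists>!w. w \<in> Hom C (Cod C u) z \<and> w \<cdot>\<^bsub>C\<^esub> u = u' \<and> w \<cdot>\<^bsub>C\<^esub> v = v'))"

definition has_cokernel_pairs :: "('o, 'a, 'z) category_scheme \<Rightarrow> bool" where
  "has_cokernel_pairs C \<longleftrightarrow> (\<forall>f \<in> Ar C. \<exists>u v. cokernel_pair C f u v)"

text \<open>In \<open>pullback C m f p q\<close>, the morphism \<open>p\<close> is the pullback of \<open>m\<close> along \<open>f\<close>: \<open>f \<cdot> p = m \<cdot> q\<close>.\<close>

definition pullback :: "('o, 'a, 'z) category_scheme \<Rightarrow> 'a \<Rightarrow> 'a \<Rightarrow> 'a \<Rightarrow> 'a \<Rightarrow> bool" where
  "pullback C m f p q \<longleftrightarrow>
     m \<in> Ar C \<and> f \<in> Ar C \<and> Cod C m = Cod C f \<and>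
     p \<in> Ar C \<and> Cod C p = Dom C f \<and> q \<in> Hom C (Dom C p) (Dom C m) \<and>
     f \<cdot>\<^bsub>C\<^esub> p = m \<cdot>\<^bsub>C\<^esub> q \<and>
     (\<forall>z \<in> Ob C. \<forall>a \<in> Hom C z (Dom C f). \<forall>b \<in> Hom C z (Dom C m).
        f \<cdot>\<^bsub>C\<^esub> a = m \<cdot>\<^bsub>C\<^esub> b \<longrightarrow>
        (\<exists>!w. w \<in> Hom C z (Dom C p) \<and> p \<cdot>\<^bsub>C\<^esub> w = a \<and> q \<cdot>\<^bsub>C\<^esub> w = b))"

text \<open>
  \<open>p\<close> is the diagonal of a multiple pullback of the family \<open>(m i)\<close>, \<open>i \<in> I\<close>, of morphisms with common
  codomain \<open>y\<close>, and the \<open>q i\<close> are its projections.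
\<close>

definition multiple_pullback ::
    "('o, 'a, 'z) category_scheme \<Rightarrow> 'o \<Rightarrow> 'i set \<Rightarrow> ('i \<Rightarrow> 'a) \<Rightarrow> 'a \<Rightarrow> ('i \<Rightarrow> 'a) \<Rightarrow> bool" where
  "multiple_pullback C y I m p q \<longleftrightarrow>
     y \<in> Ob C \<and> (\<forall>i \<in> I. m i \<in> Ar C \<and> Cod C (m i) = y) \<and>
     p \<in> Ar C \<and> Cod C p = y \<and>
     (\<forall>i \<in> I. q i \<in> Hom C (Dom C p) (Dom C (m i)) \<and> m i \<cdot>\<^bsub>C\<^esub> q i = p) \<and>
     (\<forall>z \<in> Ob C. \<forall>f \<in> Hom C z y. \<forall>g.
        (\<forall>i \<in> I. g i \<in> Hom C z (Dom C (m i)) \<and> m i \<cdot>\<^bsub>C\<^esub> g i = f) \<longrightarrow>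
        (\<exists>!w. w \<in> Hom C z (Dom C p) \<and> p \<cdot>\<^bsub>C\<^esub> w = f \<and> (\<forall>i \<in> I. q i \<cdot>\<^bsub>C\<^esub> w = g i)))"


section \<open>Subobjects and smallness\<close>

definition sub_le :: "('o, 'a, 'z) category_scheme \<Rightarrow> 'a \<Rightarrow> 'a \<Rightarrow> bool" where
  "sub_le C m n \<longleftrightarrow> m \<in> Ar C \<and> n \<in> Ar C \<and> Cod C m = Cod C n \<and>
     (\<exists>k \<in> Hom C (Dom C m) (Dom C n). m = n \<cdot>\<^bsub>C\<^esub> k)"

definition sub_equiv :: "('o, 'a, 'z) category_scheme \<Rightarrow> 'a \<Rightarrow> 'a \<Rightarrow> bool" where
  "sub_equiv C m n \<longleftrightarrow> sub_le C m n \<and> sub_le C n m"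

definition subobjects :: "('o, 'a, 'z) category_scheme \<Rightarrow> 'o \<Rightarrow> 'a set set" where
  "subobjects C x =
     {m. monic C m \<and> Cod C m = x} // {(m, n). monic C m \<and> monic C n \<and> sub_equiv C m n}"

text \<open>
  Smallness is relative to an arbitrary set \<open>U\<close>: a set is small if its cardinality is strictly smaller
  than that of \<open>U\<close>. When \<open>U\<close> is a Grothendieck universe these are, up to bijection, the elements of
  \<open>U\<close>; no closure property of \<open>U\<close> is assumed.
\<close>

definition small :: "'u set \<Rightarrow> 'b set \<Rightarrow> bool" where
  "small U S \<longleftrightarrow> S \<prec> U"

definition wellpowered :: "'u set \<Rightarrow> ('o, 'a, 'z) category_scheme \<Rightarrow> bool" where
  "wellpowered U C \<longleftrightarrow> (\<forall>x \<in> Ob C. small U (subobjects C x))"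

text \<open>
  Intersections of small families of monomorphisms. Using the type of morphisms for the indices is no
  restriction, since repetitions in a family of monomorphisms do not matter. In a wellpowered
  category, intersections of large families then exist as well.
\<close>

definition has_intersections :: "'u set \<Rightarrow> ('o, 'a, 'z) category_scheme \<Rightarrow> bool" where
  "has_intersections U C \<longleftrightarrow>
     (\<forall>y \<in> Ob C. \<forall>(I :: 'a set) m.
        small U I \<and> (\<forall>i \<in> I. monic C (m i) \<and> Cod C (m i) = y) \<longrightarrow>
        (\<exists>p q. multiple_pullback C y I m p q))"


section \<open>\<open>\<M>\<close>-complete categories\<close>

text \<open>
  Families of \<open>\<M>\<close>-morphisms are indexed, so that a morphism may be repeated, and the index class may
  be as large as the class of all morphisms. This is what forces the morphisms in \<open>M\<close> to be
  monomorphisms.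
\<close>

definition M_complete :: "('o, 'a, 'z) category_scheme \<Rightarrow> 'a set \<Rightarrow> bool" where
  "M_complete C M \<longleftrightarrow>
     M \<subseteq> Ar C \<and>
     (\<forall>f. isomorphism C f \<longrightarrow> f \<in> M) \<and>
     (\<forall>m \<in> M. \<forall>n \<in> M. Cod C m = Dom C n \<longrightarrow> n \<cdot>\<^bsub>C\<^esub> m \<in> M) \<and>
     (\<forall>m \<in> M. \<forall>f \<in> Ar C. Cod C f = Cod C m \<longrightarrow> (\<exists>p q. pullback C m f p q \<and> p \<in> M)) \<and>
     (\<forall>y \<in> Ob C. \<forall>(I :: 'a set) m.
        (\<forall>i \<in> I. m i \<in> M \<and> Cod C (m i) = y) \<longrightarrow>
        (\<exists>p q. multiple_pullback C y I m p q \<and> p \<in> M))"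

definition M_over :: "('o, 'a, 'z) category_scheme \<Rightarrow> 'a set \<Rightarrow> 'o \<Rightarrow> 'a set" where
  "M_over C M x = {m \<in> M. Cod C m = x}"

definition is_meet :: "('o, 'a, 'z) category_scheme \<Rightarrow> 'a set \<Rightarrow> 'o \<Rightarrow> 'a set \<Rightarrow> 'a \<Rightarrow> bool" where
  "is_meet C M x S c \<longleftrightarrow> c \<in> M_over C M x \<and> (\<forall>r \<in> S. sub_le C c r) \<and>
     (\<forall>d \<in> M_over C M x. (\<forall>r \<in> S. sub_le C d r) \<longrightarrow> sub_le C d c)"


section \<open>Regular closure operators\<close>

text \<open>Full subcategories are represented by their sets of objects.\<close>

definition regular_mono_wrt :: "('o, 'a, 'z) category_scheme \<Rightarrow> 'o set \<Rightarrow> 'a \<Rightarrow> bool" where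
  "regular_mono_wrt C A r \<longleftrightarrow> (\<exists>h k. Cod C h \<in> A \<and> equalizer C h k r)"

definition regular_mono :: "('o, 'a, 'z) category_scheme \<Rightarrow> 'a \<Rightarrow> bool" where
  "regular_mono C r \<longleftrightarrow> (\<exists>h k. equalizer C h k r)"

text \<open>Meets in a preorder are unique only up to equivalence, so one of them is chosen.\<close>

definition regular_closure ::
    "('o, 'a, 'z) category_scheme \<Rightarrow> 'a set \<Rightarrow> 'o set \<Rightarrow> 'a \<Rightarrow> 'a" where
  "regular_closure C M A m =
     (SOME c. is_meet C M (Cod C m) {r \<in> M. sub_le C m r \<and> regular_mono_wrt C A r} c)"

lemma M_complete_meet_exists:
  fixes C :: "('o, 'a, 'z) category_scheme"
  assumes "category C" and M: "M_complete C M" and x: "x \<in> Ob C" and S: "S \<subseteq> M_over C M x"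
  shows "\<exists>c. is_meet C M x S c"
proof -
  interpret category C by fact
  have *: "\<forall>i \<in> S. i \<in> M \<and> Cod C i = x"
    using S by (auto simp: M_over_def)
  have "\<forall>(I :: 'a set) m. (\<forall>i \<in> I. m i \<in> M \<and> Cod C (m i) = x) \<longrightarrow>
          (\<exists>p q. multiple_pullback C x I m p q \<and> p \<in> M)"
    by (rule bspec[OF M[unfolded M_complete_def, THEN conjunct2, THEN conjunct2, THEN conjunct2,
      THEN conjunct2] x])
  from this[THEN spec, of S, THEN spec, of "\<lambda>i. i", THEN mp, OF *]
  obtain p q where pq: "multiple_pullback C x S (\<lambda>i. i) p q" and p: "p \<in> M"
    by (elim exE conjE)
  have univ: "\<forall>z \<in> Ob C. \<forall>f \<in> Hom C z x. \<forall>g.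
      (\<forall>i \<in> S. g i \<in> Hom C z (Dom C i) \<and> i \<cdot>\<^bsub>C\<^esub> g i = f) \<longrightarrow>
      (\<exists>!w. w \<in> Hom C z (Dom C p) \<and> p \<cdot>\<^bsub>C\<^esub> w = f \<and> (\<forall>i \<in> S. q i \<cdot>\<^bsub>C\<^esub> w = g i))"
    using pq unfolding multiple_pullback_def by (elim conjE)
  have "is_meet C M x S p"
    unfolding is_meet_def
  proof (intro conjI ballI impI)
    show "p \<in> M_over C M x"
      using p pq by (simp add: M_over_def multiple_pullback_def)
    show "sub_le C p r" if "r \<in> S" for r
      using that pq unfolding multiple_pullback_def sub_le_def by (auto intro!: bexI[of _ "q r"])
    fix d assume d: "d \<in> M_over C M x" and le: "\<forall>r \<in> S. sub_le C d r"
    have dA: "d \<in> Ar C" "Cod C d = x"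
      using d M by (auto simp: M_over_def M_complete_def)
    have "\<forall>r \<in> S. \<exists>k. k \<in> Hom C (Dom C d) (Dom C r) \<and> r \<cdot>\<^bsub>C\<^esub> k = d"
      using le unfolding sub_le_def by metis
    then obtain g where g: "\<forall>r \<in> S. g r \<in> Hom C (Dom C d) (Dom C r) \<and> r \<cdot>\<^bsub>C\<^esub> g r = d"
      by metis
    have d': "d \<in> Hom C (Dom C d) x" "Dom C d \<in> Ob C"
      using dA Dom_Ob by (auto simp: Hom_def)
    from univ[THEN bspec, OF d'(2), THEN bspec, OF d'(1), THEN spec, of g, THEN mp, OF g]
    obtain w where "w \<in> Hom C (Dom C d) (Dom C p)" "p \<cdot>\<^bsub>C\<^esub> w = d"
      by blast
    moreover have "p \<in> Ar C" "Cod C p = x"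
      using pq by (simp_all add: multiple_pullback_def)
    ultimately show "sub_le C d p"
      using dA by (auto simp: sub_le_def)
  qed
  then show ?thesis ..
qed

lemma regular_closure_is_meet:
  assumes "category C" and "M_complete C M" and "m \<in> M"
  shows "is_meet C M (Cod C m) {r \<in> M. sub_le C m r \<and> regular_mono_wrt C A r}
           (regular_closure C M A m)"
proof -
  have "Cod C m \<in> Ob C"
    using assms by (auto simp: M_complete_def intro: category.Cod_Ob)
  then show ?thesis
    unfolding regular_closure_def
    by (intro someI_ex[OF M_complete_meet_exists[OF assms(1,2)]]) (auto simp: M_over_def sub_le_def)
qed


section \<open>Functors and reflectors\<close>

record ('o, 'a, 'p, 'b) func =
  FOb :: "'o \<Rightarrow> 'p"
  FAr :: "'a \<Rightarrow> 'b"

definition is_functor ::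
    "('o, 'a, 'z) category_scheme \<Rightarrow> ('p, 'b, 'y) category_scheme \<Rightarrow> ('o, 'a, 'p, 'b) func \<Rightarrow> bool" where
  "is_functor C D F \<longleftrightarrow>
     (\<forall>x \<in> Ob C. FOb F x \<in> Ob D \<and> FAr F (\<iota>\<^bsub>C\<^esub> x) = \<iota>\<^bsub>D\<^esub> (FOb F x)) \<and>
     (\<forall>f \<in> Ar C. FAr F f \<in> Hom D (FOb F (Dom C f)) (FOb F (Cod C f))) \<and>
     (\<forall>f \<in> Ar C. \<forall>g \<in> Ar C. Cod C f = Dom C g \<longrightarrow>
        FAr F (g \<cdot>\<^bsub>C\<^esub> f) = FAr F g \<cdot>\<^bsub>D\<^esub> FAr F f)"

definition comp_func ::
    "('p, 'b, 'q, 'c) func \<Rightarrow> ('o, 'a, 'p, 'b) func \<Rightarrow> ('o, 'a, 'q, 'c) func" where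
  "comp_func G F = \<lparr>FOb = FOb G \<circ> FOb F, FAr = FAr G \<circ> FAr F\<rparr>"

definition naturally_isomorphic ::
    "('o, 'a, 'z) category_scheme \<Rightarrow> ('p, 'b, 'y) category_scheme \<Rightarrow>
     ('o, 'a, 'p, 'b) func \<Rightarrow> ('o, 'a, 'p, 'b) func \<Rightarrow> bool" where
  "naturally_isomorphic C D F G \<longleftrightarrow>
     (\<exists>\<theta>. (\<forall>x \<in> Ob C. \<theta> x \<in> Hom D (FOb F x) (FOb G x) \<and> isomorphism D (\<theta> x)) \<and>
          (\<forall>f \<in> Ar C. \<theta> (Cod C f) \<cdot>\<^bsub>D\<^esub> FAr F f = FAr G f \<cdot>\<^bsub>D\<^esub> \<theta> (Dom C f)))"

text \<open>All subcategories are full and isomorphism-closed.\<close>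

definition subcategory :: "('o, 'a, 'z) category_scheme \<Rightarrow> 'o set \<Rightarrow> bool" where
  "subcategory C A \<longleftrightarrow> A \<subseteq> Ob C \<and> (\<forall>f. isomorphism C f \<and> Dom C f \<in> A \<longrightarrow> Cod C f \<in> A)"

definition full_sub :: "('o, 'a, 'z) category_scheme \<Rightarrow> 'o set \<Rightarrow> ('o, 'a, 'z) category_scheme" where
  "full_sub C A = C\<lparr>Ob := A, Ar := {f \<in> Ar C. Dom C f \<in> A \<and> Cod C f \<in> A}\<rparr>"

text \<open>
  A reflector is a left adjoint \<open>F\<close> of the inclusion functor; the unit \<open>\<eta>\<close> consists of the reflection
  morphisms.
\<close>

definition reflector ::
    "('o, 'a, 'z) category_scheme \<Rightarrow> 'o set \<Rightarrow> ('o, 'a, 'o, 'a) func \<Rightarrow> ('o \<Rightarrow> 'a) \<Rightarrow> bool" where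
  "reflector C A F \<eta> \<longleftrightarrow>
     subcategory C A \<and> is_functor C (full_sub C A) F \<and>
     (\<forall>x \<in> Ob C. \<eta> x \<in> Hom C x (FOb F x)) \<and>
     (\<forall>f \<in> Ar C. \<eta> (Cod C f) \<cdot>\<^bsub>C\<^esub> f = FAr F f \<cdot>\<^bsub>C\<^esub> \<eta> (Dom C f)) \<and>
     (\<forall>x \<in> Ob C. \<forall>a \<in> A. \<forall>f \<in> Hom C x a.
        \<exists>!g. g \<in> Hom C (FOb F x) a \<and> g \<cdot>\<^bsub>C\<^esub> \<eta> x = f)"

definition epireflector ::
    "('o, 'a, 'z) category_scheme \<Rightarrow> 'o set \<Rightarrow> ('o, 'a, 'o, 'a) func \<Rightarrow> ('o \<Rightarrow> 'a) \<Rightarrow> bool" where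
  "epireflector C A F \<eta> \<longleftrightarrow> reflector C A F \<eta> \<and> (\<forall>x \<in> Ob C. epi C (\<eta> x))"

text \<open>
  As reflectors are determined only up to natural isomorphism, the factorization \<open>r = s \<cdot> t\<close> of the
  reflector \<open>r\<close> is understood up to natural isomorphism.
\<close>

definition intermediate_category ::
    "('o, 'a, 'z) category_scheme \<Rightarrow> 'o set \<Rightarrow> ('o, 'a, 'o, 'a) func \<Rightarrow> 'o set \<Rightarrow> bool" where
  "intermediate_category C A r B \<longleftrightarrow>
     (\<exists>t \<tau> s \<sigma>. epireflector C B t \<tau> \<and> epireflector (full_sub C B) A s \<sigma> \<and>
        naturally_isomorphic C (full_sub C A) r (comp_func s t))"

definition smallest_intermediate_category ::
    "('o, 'a, 'z) category_scheme \<Rightarrow> 'o set \<Rightarrow> ('o, 'a, 'o, 'a) func \<Rightarrow> 'o set \<Rightarrow> bool" where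
  "smallest_intermediate_category C A r B \<longleftrightarrow>
     intermediate_category C A r B \<and> (\<forall>B'. intermediate_category C A r B' \<longrightarrow> B \<subseteq> B')"

definition extremal_subobjects :: "('o, 'a, 'z) category_scheme \<Rightarrow> 'o set \<Rightarrow> 'o set" where
  "extremal_subobjects C A = {x \<in> Ob C. \<exists>a \<in> A. \<exists>m \<in> Hom C x a. extremal_mono C m}"

end

theory Submission
  imports Defs
begin

text \<open>
  The whole argument rests on one fact: every morphism of \<open>X\<close> is an epimorphism followed by an
  extremal monomorphism, and extremal monomorphisms have the diagonal fill-in property against
  epimorphisms. To factor \<open>f\<close>, intersect all \<open>\<M>\<close>-morphisms with the fill-in property (strong
  monomorphisms) through which \<open>f\<close> factors. The intersection is again of this kind, and the remaining
  factor \<open>e\<close> of \<open>f\<close> is an epimorphism, because an equalizer of two morphisms that agree on \<open>e\<close> would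
  yield a smaller member of the family (\<open>epi_strong_mono_factorization\<close>). An extremal monomorphism has
  an isomorphism as its epimorphic factor, so it is strong.

  Let \<open>B\<close> be the class of extremal subobjects of objects of \<open>A\<close>. Factoring each reflection morphism
  as \<open>\<rho> x = \<mu> x \<cdot> \<tau> x\<close>, with \<open>\<tau> x\<close> an epimorphism and \<open>\<mu> x\<close> extremal, gives an object of \<open>B\<close> in the
  middle. The fill-in property makes \<open>\<tau> x\<close> a reflection of \<open>x\<close> in \<open>B\<close>. On objects of \<open>B\<close> the old
  reflection morphisms are epimorphisms relative to \<open>B\<close>, since an object of \<open>B\<close> embeds in an object of
  \<open>A\<close> and morphisms from \<open>r x\<close> into \<open>A\<close> are determined by their composites with \<open>\<rho> x\<close>. Reflecting
  \<open>\<tau> x\<close> itself in \<open>A\<close> gives an isomorphism, natural in \<open>x\<close>, from \<open>r x\<close> to the reflection of \<open>x\<close> through \<open>B\<close>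
  (\<open>FAr_epi_factor_isomorphism\<close>), so \<open>B\<close> is intermediate (\<open>intermediate_extremal_subobjects\<close>).

  Minimality holds because, for an intermediate \<open>B'\<close>, an extremal monomorphism from \<open>x\<close> to an object of
  \<open>A \<subseteq> B'\<close> factors through the epimorphic reflection of \<open>x\<close> in \<open>B'\<close>, which is therefore an
  isomorphism (\<open>extremal_subobjects_subset_epireflective\<close>). Finally, composing two
  parallel morphisms with a monomorphism does not change their equalizer, so \<open>A\<close> and \<open>B\<close> have the same
  regular monomorphisms and hence the same closure operator.
\<close>

section \<open>Strong and extremal monomorphisms\<close>

text \<open>
  This is the diagonal fill-in property. Only the triangle \<open>m \<cdot> d = v\<close> is demanded: \<open>d \<cdot> e = u\<close> follows
  from it by cancelling \<open>m\<close>.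
\<close>

definition strong_mono :: "('o, 'a, 'z) category_scheme \<Rightarrow> 'a \<Rightarrow> bool" where
  "strong_mono C m \<longleftrightarrow> monic C m \<and>
     (\<forall>e u v. epi C e \<and> u \<in> Hom C (Dom C e) (Dom C m) \<and> v \<in> Hom C (Cod C e) (Cod C m) \<and>
        m \<cdot>\<^bsub>C\<^esub> u = v \<cdot>\<^bsub>C\<^esub> e \<longrightarrow>
        (\<exists>d \<in> Hom C (Cod C e) (Dom C m). m \<cdot>\<^bsub>C\<^esub> d = v))"

context category
begin

lemma HomD:
  assumes "f \<in> Hom C x y"
  shows "f \<in> Ar C" "Dom C f = x" "Cod C f = y" "x \<in> Ob C" "y \<in> Ob C"
  using assms Dom_Ob Cod_Ob by (auto simp: Hom_def)

lemma Ar_Hom: "f \<in> Ar C \<Longrightarrow> f \<in> Hom C (Dom C f) (Cod C f)"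
  by (simp add: Hom_def)

lemma monic_cancel:
  assumes "monic C m" "m \<in> Hom C x y" "f \<in> Hom C z x" "g \<in> Hom C z x" "m \<cdot> f = m \<cdot> g"
  shows "f = g"
  using assms HomD unfolding monic_def by metis

lemma epi_cancel:
  assumes "epi C e" "e \<in> Hom C x y" "f \<in> Hom C y z" "g \<in> Hom C y z" "f \<cdot> e = g \<cdot> e"
  shows "f = g"
  using assms HomD unfolding epi_def by metis

lemma monic_comp:
  assumes "monic C m" "m \<in> Hom C x y" "monic C n" "n \<in> Hom C y z"
  shows "monic C (n \<cdot> m)"
proof -
  have nm: "n \<cdot> m \<in> Hom C x z"
    using assms Comp_Hom by blast
  have "f = g" if f: "f \<in> Hom C w x" and g: "g \<in> Hom C w x" and eq: "n \<cdot> m \<cdot> f = n \<cdot> m \<cdot> g" for w f g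
  proof -
    have "n \<cdot> (m \<cdot> f) = n \<cdot> (m \<cdot> g)"
      using Comp_assoc[OF f assms(2,4)] Comp_assoc[OF g assms(2,4)] eq by simp
    then have "m \<cdot> f = m \<cdot> g"
      using monic_cancel[OF assms(3,4)] Comp_Hom[OF f assms(2)] Comp_Hom[OF g assms(2)] by blast
    then show ?thesis
      using monic_cancel[OF assms(1,2) f g] by blast
  qed
  then show ?thesis
    using HomD[OF nm] by (auto simp: monic_def)
qed

lemma isomorphism_inverse:
  assumes "isomorphism C f" "f \<in> Hom C x y"
  obtains g where "g \<in> Hom C y x" "g \<cdot> f = \<iota> x" "f \<cdot> g = \<iota> y" "isomorphism C g"
proof -
  obtain g where g: "g \<in> Hom C y x" "g \<cdot> f = \<iota> x" "f \<cdot> g = \<iota> y"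
    using assms HomD(2,3)[OF assms(2)] by (auto simp: isomorphism_def)
  then have "isomorphism C g"
    using assms(2) HomD[OF g(1)] by (auto simp: isomorphism_def)
  then show ?thesis
    using that g by blast
qed

lemma isomorphismI:
  assumes "f \<in> Hom C x y" "g \<in> Hom C y x" "g \<cdot> f = \<iota> x" "f \<cdot> g = \<iota> y"
  shows "isomorphism C f"
  using assms HomD[OF assms(1)] by (auto simp: isomorphism_def)

lemma split_mono_monic:
  assumes f: "f \<in> Hom C x y" and g: "g \<in> Hom C y x" and gf: "g \<cdot> f = \<iota> x"
  shows "monic C f"
proof -
  have "a = b" if ab: "a \<in> Hom C w x" "b \<in> Hom C w x" "f \<cdot> a = f \<cdot> b" for w a b
  proof -
    have "g \<cdot> f \<cdot> a = g \<cdot> f \<cdot> b"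
      using Comp_assoc[OF ab(1) f g] Comp_assoc[OF ab(2) f g] ab(3) by simp
    then show ?thesis
      using gf Idt_Comp[OF ab(1)] Idt_Comp[OF ab(2)] by simp
  qed
  then show ?thesis
    using HomD[OF f] by (auto simp: monic_def)
qed

lemma split_mono_epi_iso:
  assumes e: "e \<in> Hom C x y" "epi C e" and d: "d \<in> Hom C y x" "d \<cdot> e = \<iota> x"
  shows "isomorphism C e"
proof -
  have "(e \<cdot> d) \<cdot> e = \<iota> y \<cdot> e"
    using Comp_assoc[OF e(1) d(1) e(1)] d(2) Comp_Idt[OF e(1)] Idt_Comp[OF e(1)] by simp
  then have "e \<cdot> d = \<iota> y"
    using epi_cancel[OF e(2,1)] Comp_Hom[OF d(1) e(1)] Idt_Hom HomD(5)[OF e(1)] by blast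
  then show ?thesis
    using isomorphismI e(1) d by blast
qed

lemma strong_mono_diagonal:
  assumes m: "strong_mono C m" "m \<in> Hom C x y" and e: "epi C e" "e \<in> Hom C a b"
    and u: "u \<in> Hom C a x" and v: "v \<in> Hom C b y" and sq: "m \<cdot> u = v \<cdot> e"
  obtains d where "d \<in> Hom C b x" "m \<cdot> d = v" "d \<cdot> e = u"
proof -
  obtain d where d: "d \<in> Hom C b x" "m \<cdot> d = v"
    using assms HomD(2,3)[OF m(2)] HomD(2,3)[OF e(2)] unfolding strong_mono_def by metis
  have "m \<cdot> (d \<cdot> e) = m \<cdot> u"
    using Comp_assoc[OF e(2) d(1) m(2)] d(2) sq by simp
  then have "d \<cdot> e = u"
    using m monic_cancel[OF _ m(2) Comp_Hom[OF e(2) d(1)] u] by (auto simp: strong_mono_def)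
  then show ?thesis
    using that d by blast
qed

lemma strong_monoI:
  assumes "m \<in> Hom C x y" "monic C m"
    and "\<And>a b e u v. \<lbrakk>epi C e; e \<in> Hom C a b; u \<in> Hom C a x; v \<in> Hom C b y; m \<cdot> u = v \<cdot> e\<rbrakk>
           \<Longrightarrow> \<exists>d \<in> Hom C b x. m \<cdot> d = v"
  shows "strong_mono C m"
  using assms(2) assms(3)[OF _ Ar_Hom] HomD(2,3)[OF assms(1)]
  by (auto simp: strong_mono_def epi_def)

lemma strong_mono_comp:
  assumes m: "strong_mono C m" "m \<in> Hom C x y" and n: "strong_mono C n" "n \<in> Hom C y z"
  shows "strong_mono C (n \<cdot> m)"
proof (rule strong_monoI)
  show "n \<cdot> m \<in> Hom C x z"
    using Comp_Hom m n by blast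
  show "monic C (n \<cdot> m)"
    using monic_comp m n by (auto simp: strong_mono_def)
  fix a b e u v
  assume e: "epi C e" "e \<in> Hom C a b" and u: "u \<in> Hom C a x" and v: "v \<in> Hom C b z"
    and sq: "n \<cdot> m \<cdot> u = v \<cdot> e"
  have "n \<cdot> (m \<cdot> u) = v \<cdot> e"
    using Comp_assoc[OF u m(2) n(2)] sq by simp
  then obtain d where d: "d \<in> Hom C b y" "n \<cdot> d = v" "d \<cdot> e = m \<cdot> u"
    using strong_mono_diagonal[OF n e Comp_Hom[OF u m(2)] v] by blast
  obtain d' where d': "d' \<in> Hom C b x" "m \<cdot> d' = d"
    using strong_mono_diagonal[OF m e u d(1)] d(3) by metis
  then show "\<exists>d \<in> Hom C b x. n \<cdot> m \<cdot> d = v"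
    using Comp_assoc[OF d'(1) m(2) n(2)] d(2) by auto
qed

lemma strong_mono_extremal:
  assumes "strong_mono C m"
  shows "extremal_mono C m"
proof -
  have mono: "monic C m"
    using assms by (simp add: strong_mono_def)
  then have m: "m \<in> Hom C (Dom C m) (Cod C m)"
    by (simp add: monic_def Ar_Hom)
  have "isomorphism C e"
    if e: "e \<in> Hom C (Dom C m) y" "epi C e" and f: "f \<in> Hom C y (Cod C m)" and eq: "m = f \<cdot> e" for y e f
  proof -
    \<comment> \<open>The diagonal of the square \<open>m \<cdot> \<iota> = f \<cdot> e\<close> is a left inverse of \<open>e\<close>.\<close>
    have "m \<cdot> \<iota> (Dom C m) = f \<cdot> e"
      using Comp_Idt[OF m] eq by simp
    then obtain d where "d \<in> Hom C y (Dom C m)" "d \<cdot> e = \<iota> (Dom C m)"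
      using strong_mono_diagonal[OF assms m e(2,1) Idt_Hom[OF HomD(4)[OF m]] f] by blast
    then show ?thesis
      using split_mono_epi_iso e by blast
  qed
  then show ?thesis
    using mono by (auto simp: extremal_mono_def)
qed

lemma isomorphism_strong_mono:
  assumes f: "isomorphism C f" "f \<in> Hom C x y"
  shows "strong_mono C f"
proof -
  obtain g where g: "g \<in> Hom C y x" "g \<cdot> f = \<iota> x" "f \<cdot> g = \<iota> y"
    using isomorphism_inverse[OF f] by blast
  show ?thesis
  proof (rule strong_monoI[OF f(2)])
    show "monic C f"
      using split_mono_monic[OF f(2) g(1,2)] .
    fix a b e u v
    assume v: "v \<in> Hom C b y"
    have "f \<cdot> (g \<cdot> v) = v"
      using Comp_assoc[OF v g(1) f(2)] g(3) Idt_Comp[OF v] by simp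
    then show "\<exists>d \<in> Hom C b x. f \<cdot> d = v"
      using Comp_Hom[OF v g(1)] by blast
  qed
qed

lemma Idt_isomorphism:
  assumes "x \<in> Ob C"
  shows "isomorphism C (\<iota> x)"
  using isomorphismI[OF Idt_Hom[OF assms] Idt_Hom[OF assms]] Idt_Comp[OF Idt_Hom[OF assms]] by blast

lemma equalizer_monic:
  assumes eq: "equalizer C h k e"
  shows "monic C e"
proof -
  have h: "h \<in> Hom C (Dom C h) (Cod C h)" and k: "k \<in> Hom C (Dom C h) (Cod C h)"
    and e: "e \<in> Hom C (Dom C e) (Dom C h)" and he: "h \<cdot> e = k \<cdot> e"
    using eq by (auto simp: equalizer_def Hom_def)
  have "f = g" if f: "f \<in> Hom C z (Dom C e)" and g: "g \<in> Hom C z (Dom C e)" and fg: "e \<cdot> f = e \<cdot> g" for z f g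
  proof -
    have "e \<cdot> f \<in> Hom C z (Dom C h)" "h \<cdot> (e \<cdot> f) = k \<cdot> (e \<cdot> f)" "z \<in> Ob C"
      using Comp_Hom[OF f e] Comp_assoc[OF f e h] Comp_assoc[OF f e k] he HomD(4)[OF f] by auto
    then have "\<exists>!w. w \<in> Hom C z (Dom C e) \<and> e \<cdot> w = e \<cdot> f"
      using eq by (simp add: equalizer_def)
    then show ?thesis
      using f g fg by metis
  qed
  then show ?thesis
    using HomD(1)[OF e] by (auto simp: monic_def)
qed

lemma equalizer_strong_mono:
  assumes eq: "equalizer C h k m"
  shows "strong_mono C m"
proof (rule strong_monoI)
  have h: "h \<in> Hom C (Dom C h) (Cod C h)" and k: "k \<in> Hom C (Dom C h) (Cod C h)"
    and hm: "h \<cdot> m = k \<cdot> m"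
    using eq by (auto simp: equalizer_def Hom_def)
  show m: "m \<in> Hom C (Dom C m) (Dom C h)"
    using eq by (auto simp: equalizer_def Hom_def)
  show "monic C m"
    using equalizer_monic[OF eq] .
  fix a b e u v
  assume e: "epi C e" "e \<in> Hom C a b" and u: "u \<in> Hom C a (Dom C m)" and v: "v \<in> Hom C b (Dom C h)"
    and sq: "m \<cdot> u = v \<cdot> e"
  have "(h \<cdot> v) \<cdot> e = (k \<cdot> v) \<cdot> e"
    using Comp_assoc[OF e(2) v h] Comp_assoc[OF e(2) v k] Comp_assoc[OF u m h] Comp_assoc[OF u m k] sq hm
    by simp
  then have "h \<cdot> v = k \<cdot> v"
    using epi_cancel[OF e Comp_Hom[OF v h] Comp_Hom[OF v k]] by blast
  then show "\<exists>d \<in> Hom C b (Dom C m). m \<cdot> d = v"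
    using eq v HomD(4)[OF v] unfolding equalizer_def by blast
qed

lemma multiple_pullback_factor:
  assumes "multiple_pullback C y I m p q" "f \<in> Hom C z y"
    and "\<And>i. i \<in> I \<Longrightarrow> \<exists>g \<in> Hom C z (Dom C (m i)). m i \<cdot> g = f"
  shows "\<exists>w \<in> Hom C z (Dom C p). p \<cdot> w = f"
proof -
  obtain g where "\<forall>i \<in> I. g i \<in> Hom C z (Dom C (m i)) \<and> m i \<cdot> g i = f"
    using assms(3) by metis
  moreover have "z \<in> Ob C"
    using HomD(4)[OF assms(2)] .
  ultimately have "\<exists>!w. w \<in> Hom C z (Dom C p) \<and> p \<cdot> w = f \<and> (\<forall>i \<in> I. q i \<cdot> w = g i)"
    using assms(1,2) unfolding multiple_pullback_def by blast
  then show ?thesis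
    by blast
qed

lemma multiple_pullback_monic:
  assumes mp: "multiple_pullback C y I m p q" and mono: "\<And>i. i \<in> I \<Longrightarrow> monic C (m i)"
  shows "monic C p"
proof -
  have p: "p \<in> Hom C (Dom C p) y"
    using mp by (simp add: multiple_pullback_def Hom_def)
  have m: "m i \<in> Hom C (Dom C (m i)) y" and q: "q i \<in> Hom C (Dom C p) (Dom C (m i))"
    and mq: "m i \<cdot> q i = p" if "i \<in> I" for i
    using mp that by (auto simp: multiple_pullback_def Hom_def)
  have "f = g" if f: "f \<in> Hom C z (Dom C p)" and g: "g \<in> Hom C z (Dom C p)" and fg: "p \<cdot> f = p \<cdot> g" for z f g
  proof -
    have qfg: "q i \<cdot> f = q i \<cdot> g" if i: "i \<in> I" for i
    proof -
      have "m i \<cdot> (q i \<cdot> f) = m i \<cdot> (q i \<cdot> g)"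
        using Comp_assoc[OF f q[OF i] m[OF i]] Comp_assoc[OF g q[OF i] m[OF i]] mq[OF i] fg by simp
      then show ?thesis
        using monic_cancel[OF mono[OF i] m[OF i]] Comp_Hom[OF f q[OF i]] Comp_Hom[OF g q[OF i]] by blast
    qed
    have "\<forall>i \<in> I. q i \<cdot> f \<in> Hom C z (Dom C (m i)) \<and> m i \<cdot> (q i \<cdot> f) = p \<cdot> f"
      using Comp_Hom[OF f q] Comp_assoc[OF f q m] mq by simp
    then have "\<exists>!w. w \<in> Hom C z (Dom C p) \<and> p \<cdot> w = p \<cdot> f \<and> (\<forall>i \<in> I. q i \<cdot> w = q i \<cdot> f)"
      using mp[unfolded multiple_pullback_def, THEN conjunct2, THEN conjunct2, THEN conjunct2, THEN conjunct2,
          THEN conjunct2, THEN bspec, OF HomD(4)[OF f], THEN bspec, OF Comp_Hom[OF f p], THEN spec,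
          of "\<lambda>i. q i \<cdot> f"] by blast
    moreover have "f \<in> Hom C z (Dom C p) \<and> p \<cdot> f = p \<cdot> f \<and> (\<forall>i \<in> I. q i \<cdot> f = q i \<cdot> f)"
      using f by simp
    moreover have "g \<in> Hom C z (Dom C p) \<and> p \<cdot> g = p \<cdot> f \<and> (\<forall>i \<in> I. q i \<cdot> g = q i \<cdot> f)"
      using g fg qfg by simp
    ultimately show ?thesis
      by blast
  qed
  then show ?thesis
    using HomD(1)[OF p] by (auto simp: monic_def)
qed

lemma multiple_pullback_strong_mono:
  assumes mp: "multiple_pullback C y I m p q" and strong: "\<And>i. i \<in> I \<Longrightarrow> strong_mono C (m i)"
  shows "strong_mono C p"
proof (rule strong_monoI)
  show p: "p \<in> Hom C (Dom C p) y"
    using mp by (simp add: multiple_pullback_def Hom_def)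
  show "monic C p"
    using multiple_pullback_monic[OF mp] strong by (simp add: strong_mono_def)
  fix a b e u v
  assume e: "epi C e" "e \<in> Hom C a b" and u: "u \<in> Hom C a (Dom C p)" and v: "v \<in> Hom C b y"
    and sq: "p \<cdot> u = v \<cdot> e"
  show "\<exists>d \<in> Hom C b (Dom C p). p \<cdot> d = v"
  proof (rule multiple_pullback_factor[OF mp v])
    fix i
    assume i: "i \<in> I"
    have m: "m i \<in> Hom C (Dom C (m i)) y" and q: "q i \<in> Hom C (Dom C p) (Dom C (m i))"
      and mq: "m i \<cdot> q i = p"
      using mp i by (auto simp: multiple_pullback_def Hom_def)
    have "m i \<cdot> (q i \<cdot> u) = v \<cdot> e"
      using Comp_assoc[OF u q m] mq sq by simp
    then show "\<exists>g \<in> Hom C b (Dom C (m i)). m i \<cdot> g = v"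
      using strong_mono_diagonal[OF strong[OF i] m e Comp_Hom[OF u q] v] by metis
  qed
qed

end


section \<open>Factorization into an epimorphism and an extremal monomorphism\<close>

text \<open>
  The strong monomorphism is the intersection of all strong monomorphisms in \<open>M\<close> through which \<open>f\<close>
  factors. Restricting to members of \<open>M\<close> guarantees that this possibly large intersection exists.
\<close>

lemma (in category) epi_strong_mono_factorization:
  assumes M: "M_complete C M" and eqs: "has_equalizers C"
    and reg: "\<And>r. regular_mono C r \<Longrightarrow> r \<in> M" and f: "f \<in> Hom C x y"
  obtains z e m where "e \<in> Hom C x z" "epi C e" "m \<in> Hom C z y" "strong_mono C m" "m \<cdot> e = f"
proof -
  define S where "S = {n \<in> M. strong_mono C n \<and> sub_le C f n}"
  have y: "y \<in> Ob C"
    using HomD(5)[OF f] .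
  have "\<forall>i \<in> S. i \<in> M \<and> Cod C i = y"
    using HomD(3)[OF f] by (auto simp: S_def sub_le_def)
  moreover have "\<forall>(I :: 'a set) m. (\<forall>i \<in> I. m i \<in> M \<and> Cod C (m i) = y) \<longrightarrow>
      (\<exists>p q. multiple_pullback C y I m p q \<and> p \<in> M)"
    using M y unfolding M_complete_def by blast
  ultimately obtain p q where mp: "multiple_pullback C y S (\<lambda>i. i) p q" and pM: "p \<in> M"
    by (metis (no_types, lifting))
  have p: "p \<in> Hom C (Dom C p) y"
    using mp by (simp add: multiple_pullback_def Hom_def)
  have strong: "strong_mono C p"
    using multiple_pullback_strong_mono[OF mp] by (simp add: S_def)
  have "\<exists>w \<in> Hom C x (Dom C p). p \<cdot> w = f"
    using HomD[OF f] by (intro multiple_pullback_factor[OF mp f]) (auto simp: S_def sub_le_def)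
  then obtain e where e: "e \<in> Hom C x (Dom C p)" and pe: "p \<cdot> e = f"
    by blast
  have "epi C e"
    unfolding epi_def
  proof (intro conjI ballI impI)
    show "e \<in> Ar C"
      using HomD(1)[OF e] .
    fix z a b
    assume "a \<in> Hom C (Cod C e) z" "b \<in> Hom C (Cod C e) z" and ab: "a \<cdot> e = b \<cdot> e"
    then have a: "a \<in> Hom C (Dom C p) z" and b: "b \<in> Hom C (Dom C p) z"
      using HomD(3)[OF e] by auto
    obtain k where k: "equalizer C a b k"
      using eqs HomD(1-3)[OF a] b unfolding has_equalizers_def by metis
    have kH: "k \<in> Hom C (Dom C k) (Dom C p)" and akbk: "a \<cdot> k = b \<cdot> k"
      using k HomD[OF a] by (auto simp: equalizer_def Hom_def)
    have kM: "k \<in> M"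
      using reg k unfolding regular_mono_def by blast
    have "\<exists>g. g \<in> Hom C x (Dom C k) \<and> k \<cdot> g = e"
      using k ab e HomD(2)[OF a] HomD(4)[OF e] unfolding equalizer_def by metis
    then obtain g where g: "g \<in> Hom C x (Dom C k)" and kg: "k \<cdot> g = e"
      by blast
    have pk: "p \<cdot> k \<in> Hom C (Dom C k) y"
      using Comp_Hom[OF kH p] .
    \<comment> \<open>Since \<open>f\<close> also factors through \<open>p \<cdot> k\<close>, the intersection \<open>p\<close> lies below \<open>p \<cdot> k\<close>.\<close>
    have "f = p \<cdot> k \<cdot> g"
      using Comp_assoc[OF g kH p] kg pe by simp
    then have "sub_le C f (p \<cdot> k)"
      using g HomD[OF f] HomD[OF pk] by (auto simp: sub_le_def)
    moreover have "p \<cdot> k \<in> M"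
      using M pM kM HomD(3)[OF kH] unfolding M_complete_def by blast
    ultimately have "p \<cdot> k \<in> S"
      using strong_mono_comp[OF equalizer_strong_mono[OF k] kH strong p] by (simp add: S_def)
    then obtain w where w: "w \<in> Hom C (Dom C p) (Dom C k)" and pkw: "p \<cdot> k \<cdot> w = p"
      using mp HomD(2)[OF pk] by (auto simp: multiple_pullback_def)
    have "p \<cdot> (k \<cdot> w) = p \<cdot> \<iota> (Dom C p)"
      using Comp_assoc[OF w kH p] pkw Comp_Idt[OF p] by simp
    then have kw: "k \<cdot> w = \<iota> (Dom C p)"
      using monic_cancel[OF _ p Comp_Hom[OF w kH] Idt_Hom[OF HomD(4)[OF p]]] strong
      by (simp add: strong_mono_def)
    have "a = a \<cdot> (k \<cdot> w)"
      using kw Comp_Idt[OF a] by simp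
    also have "\<dots> = b \<cdot> (k \<cdot> w)"
      using Comp_assoc[OF w kH a] Comp_assoc[OF w kH b] akbk by simp
    also have "\<dots> = b"
      using kw Comp_Idt[OF b] by simp
    finally show "a = b" .
  qed
  then show ?thesis
    using that e p strong pe by blast
qed

lemma (in category) extremal_mono_strong:
  assumes "M_complete C M" "has_equalizers C" "\<And>r. regular_mono C r \<Longrightarrow> r \<in> M"
    and ext: "extremal_mono C m"
  shows "strong_mono C m"
proof -
  have m: "m \<in> Hom C (Dom C m) (Cod C m)"
    using ext by (simp add: extremal_mono_def monic_def Ar_Hom)
  obtain z e n where e: "e \<in> Hom C (Dom C m) z" "epi C e"
    and n: "n \<in> Hom C z (Cod C m)" "strong_mono C n" "n \<cdot> e = m"
    using epi_strong_mono_factorization[OF assms(1-3) m] by blast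
  have "isomorphism C e"
    using ext e n HomD(5)[OF e(1)] unfolding extremal_mono_def by blast
  then show ?thesis
    using strong_mono_comp[OF isomorphism_strong_mono e(1) n(2,1)] e(1) n(3) by blast
qed


section \<open>Reflectors\<close>

lemma Hom_full_sub: "Hom (full_sub C A) x y = {f \<in> Hom C x y. x \<in> A \<and> y \<in> A}"
  by (auto simp: Hom_def full_sub_def)

lemma full_sub_simps [simp]:
  "Ob (full_sub C A) = A" "Dom (full_sub C A) = Dom C" "Cod (full_sub C A) = Cod C"
  "Idt (full_sub C A) = Idt C" "Comp (full_sub C A) = Comp C"
  by (auto simp: full_sub_def)

lemma Ar_full_sub: "f \<in> Ar (full_sub C A) \<longleftrightarrow> f \<in> Ar C \<and> Dom C f \<in> A \<and> Cod C f \<in> A"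
  by (auto simp: full_sub_def)

lemma isomorphism_full_sub:
  "isomorphism (full_sub C A) f \<longleftrightarrow> isomorphism C f \<and> Dom C f \<in> A \<and> Cod C f \<in> A"
  by (auto simp: isomorphism_def Ar_full_sub Hom_full_sub)

lemma reflector_of_universal_arrows:
  assumes "category C" and A: "subcategory C A"
    and FA: "\<And>x. x \<in> Ob C \<Longrightarrow> F x \<in> A" and \<eta>: "\<And>x. x \<in> Ob C \<Longrightarrow> \<eta> x \<in> Hom C x (F x)"
    and univ: "\<And>x a f. \<lbrakk>a \<in> A; f \<in> Hom C x a\<rbrakk> \<Longrightarrow> \<exists>!g. g \<in> Hom C (F x) a \<and> g \<cdot>\<^bsub>C\<^esub> \<eta> x = f"
  obtains T where "reflector C A T \<eta>" "FOb T = F"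
proof -
  interpret category C by fact
  define L where "L f = (THE g. g \<in> Hom C (F (Dom C f)) (F (Cod C f)) \<and>
      g \<cdot>\<^bsub>C\<^esub> \<eta> (Dom C f) = \<eta> (Cod C f) \<cdot>\<^bsub>C\<^esub> f)" for f
  have L: "L f \<in> Hom C (F x) (F y)" "L f \<cdot>\<^bsub>C\<^esub> \<eta> x = \<eta> y \<cdot>\<^bsub>C\<^esub> f" if f: "f \<in> Hom C x y" for f x y
  proof -
    have "\<exists>!g. g \<in> Hom C (F x) (F y) \<and> g \<cdot>\<^bsub>C\<^esub> \<eta> x = \<eta> y \<cdot>\<^bsub>C\<^esub> f"
      using univ[OF FA Comp_Hom[OF f \<eta>]] HomD[OF f] by blast
    from theI'[OF this] show "L f \<in> Hom C (F x) (F y)" "L f \<cdot>\<^bsub>C\<^esub> \<eta> x = \<eta> y \<cdot>\<^bsub>C\<^esub> f"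
      using HomD(2,3)[OF f] by (auto simp: L_def)
  qed
  have uniq: "g = h" if "a \<in> A" "x \<in> Ob C" "g \<in> Hom C (F x) a" "h \<in> Hom C (F x) a"
    "g \<cdot>\<^bsub>C\<^esub> \<eta> x = h \<cdot>\<^bsub>C\<^esub> \<eta> x" for g h x a
    using univ[OF that(1) Comp_Hom[OF \<eta>[OF that(2)] that(3)]] that by metis
  have L_Idt: "L (\<iota>\<^bsub>C\<^esub> x) = \<iota>\<^bsub>C\<^esub> (F x)" if x: "x \<in> Ob C" for x
  proof (rule uniq[OF FA[OF x] x])
    show "L (\<iota>\<^bsub>C\<^esub> x) \<in> Hom C (F x) (F x)"
      using L[OF Idt_Hom[OF x]] by blast
    show "\<iota>\<^bsub>C\<^esub> (F x) \<in> Hom C (F x) (F x)"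
      using Idt_Hom HomD(5)[OF \<eta>[OF x]] by blast
    show "L (\<iota>\<^bsub>C\<^esub> x) \<cdot>\<^bsub>C\<^esub> \<eta> x = \<iota>\<^bsub>C\<^esub> (F x) \<cdot>\<^bsub>C\<^esub> \<eta> x"
      using L(2)[OF Idt_Hom[OF x]] Comp_Idt[OF \<eta>[OF x]] Idt_Comp[OF \<eta>[OF x]] by simp
  qed
  have L_Comp: "L (g \<cdot>\<^bsub>C\<^esub> f) = L g \<cdot>\<^bsub>C\<^esub> L f" if f: "f \<in> Hom C x y" and g: "g \<in> Hom C y z" for f g x y z
  proof (rule uniq)
    have x: "x \<in> Ob C" and y: "y \<in> Ob C" and z: "z \<in> Ob C"
      using HomD f g by blast+
    show "F z \<in> A" "x \<in> Ob C"
      using FA x z by blast+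
    show "L (g \<cdot>\<^bsub>C\<^esub> f) \<in> Hom C (F x) (F z)" "L g \<cdot>\<^bsub>C\<^esub> L f \<in> Hom C (F x) (F z)"
      using L(1)[OF Comp_Hom[OF f g]] Comp_Hom[OF L(1)[OF f] L(1)[OF g]] by blast+
    have "L g \<cdot>\<^bsub>C\<^esub> L f \<cdot>\<^bsub>C\<^esub> \<eta> x = L g \<cdot>\<^bsub>C\<^esub> (\<eta> y \<cdot>\<^bsub>C\<^esub> f)"
      using Comp_assoc[OF \<eta>[OF x] L(1)[OF f] L(1)[OF g]] L(2)[OF f] by simp
    also have "\<dots> = \<eta> z \<cdot>\<^bsub>C\<^esub> g \<cdot>\<^bsub>C\<^esub> f"
      using Comp_assoc[OF f \<eta>[OF y] L(1)[OF g]] L(2)[OF g] by simp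
    also have "\<dots> = L (g \<cdot>\<^bsub>C\<^esub> f) \<cdot>\<^bsub>C\<^esub> \<eta> x"
      using Comp_assoc[OF f g \<eta>[OF z]] L(2)[OF Comp_Hom[OF f g]] by simp
    finally show "L (g \<cdot>\<^bsub>C\<^esub> f) \<cdot>\<^bsub>C\<^esub> \<eta> x = L g \<cdot>\<^bsub>C\<^esub> L f \<cdot>\<^bsub>C\<^esub> \<eta> x" ..
  qed
  define T where "T = \<lparr>FOb = F, FAr = L\<rparr>"
  have "is_functor C (full_sub C A) T"
    using FA L(1) L_Idt L_Comp Ar_Hom Dom_Ob Cod_Ob
    by (auto simp: is_functor_def T_def Hom_full_sub) (metis Ar_Hom)
  then have "reflector C A T \<eta>"
    using A \<eta> univ L(2)[OF Ar_Hom] by (auto simp: reflector_def T_def)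
  then show ?thesis
    using that by (simp add: T_def)
qed

lemma reflector_restrict:
  assumes "reflector C A F \<eta>" "A \<subseteq> B" "B \<subseteq> Ob C"
  shows "reflector (full_sub C B) A F \<eta>"
proof -
  have "subcategory (full_sub C B) A"
    using assms by (auto simp: reflector_def subcategory_def isomorphism_full_sub)
  moreover have "is_functor (full_sub C B) (full_sub (full_sub C B) A) F"
    using assms unfolding reflector_def is_functor_def
    by (auto simp: Hom_full_sub Ar_full_sub subset_eq)
  ultimately show ?thesis
    using assms unfolding reflector_def is_functor_def
    by (auto simp: Hom_full_sub Ar_full_sub subset_eq)
qed

locale reflection = category C for C :: "('o, 'a, 'z) category_scheme" (structure) +
  fixes A :: "'o set" and r :: "('o, 'a, 'o, 'a) func" and \<rho> :: "'o \<Rightarrow> 'a"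
  assumes refl: "reflector C A r \<rho>"
begin

lemma A_Ob: "a \<in> A \<Longrightarrow> a \<in> Ob C"
  using refl by (auto simp: reflector_def subcategory_def)

lemma FOb_A: "x \<in> Ob C \<Longrightarrow> FOb r x \<in> A"
  using refl by (auto simp: reflector_def is_functor_def)

lemma unit_Hom: "x \<in> Ob C \<Longrightarrow> \<rho> x \<in> Hom C x (FOb r x)"
  using refl by (auto simp: reflector_def)

lemma FAr_Hom: "f \<in> Hom C x y \<Longrightarrow> FAr r f \<in> Hom C (FOb r x) (FOb r y)"
  using refl by (fastforce simp: reflector_def is_functor_def Hom_def full_sub_def)

lemma FAr_Comp: "\<lbrakk>f \<in> Hom C x y; g \<in> Hom C y z\<rbrakk> \<Longrightarrow> FAr r (g \<cdot> f) = FAr r g \<cdot> FAr r f"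
  using refl by (auto simp: reflector_def is_functor_def Hom_def)

lemma unit_natural: "f \<in> Hom C x y \<Longrightarrow> \<rho> y \<cdot> f = FAr r f \<cdot> \<rho> x"
  using refl by (auto simp: reflector_def Hom_def)

lemma extend_along_unit:
  assumes "a \<in> A" "f \<in> Hom C x a"
  obtains g where "g \<in> Hom C (FOb r x) a" "g \<cdot> \<rho> x = f"
  using refl assms HomD(4)[OF assms(2)] unfolding reflector_def by blast

lemma extension_unique:
  assumes "a \<in> A" "x \<in> Ob C" "g \<in> Hom C (FOb r x) a" "h \<in> Hom C (FOb r x) a" "g \<cdot> \<rho> x = h \<cdot> \<rho> x"
  shows "g = h"
proof -
  have "\<exists>!k. k \<in> Hom C (FOb r x) a \<and> k \<cdot> \<rho> x = g \<cdot> \<rho> x"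
    using refl assms(1,2) Comp_Hom[OF unit_Hom[OF assms(2)] assms(3)] unfolding reflector_def by blast
  then show ?thesis
    using assms by metis
qed

text \<open>
  The inverse of \<open>r \<tau>\<close> is the extension along \<open>\<rho> y\<close> of the second factor \<open>\<mu>\<close> of \<open>\<rho> x\<close>. Cancelling
  the epimorphism \<open>\<tau>\<close> shows that \<open>r \<tau> \<cdot> \<mu>\<close> is the reflection morphism of \<open>y\<close>.
\<close>

lemma FAr_epi_factor_isomorphism:
  assumes \<tau>: "\<tau> \<in> Hom C x y" "epi C \<tau>" and \<mu>: "\<mu> \<in> Hom C y (FOb r x)" and \<mu>\<tau>: "\<mu> \<cdot> \<tau> = \<rho> x"
  shows "isomorphism C (FAr r \<tau>)"
proof -
  have x: "x \<in> Ob C" and y: "y \<in> Ob C"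
    using HomD[OF \<tau>(1)] by blast+
  note \<rho>x = unit_Hom[OF x] and \<rho>y = unit_Hom[OF y] and r\<tau> = FAr_Hom[OF \<tau>(1)]
  obtain g where g: "g \<in> Hom C (FOb r y) (FOb r x)" and g\<rho>: "g \<cdot> \<rho> y = \<mu>"
    using extend_along_unit[OF FOb_A[OF x] \<mu>] by blast
  have "g \<cdot> FAr r \<tau> \<cdot> \<rho> x = g \<cdot> (\<rho> y \<cdot> \<tau>)"
    using Comp_assoc[OF \<rho>x r\<tau> g] unit_natural[OF \<tau>(1)] by simp
  also have "\<dots> = \<iota> (FOb r x) \<cdot> \<rho> x"
    using Comp_assoc[OF \<tau>(1) \<rho>y g] g\<rho> \<mu>\<tau> Idt_Comp[OF \<rho>x] by simp
  finally have 1: "g \<cdot> FAr r \<tau> = \<iota> (FOb r x)"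
    by (rule extension_unique[OF FOb_A[OF x] x Comp_Hom[OF r\<tau> g] Idt_Hom[OF HomD(5)[OF \<rho>x]]])
  have "FAr r \<tau> \<cdot> \<mu> \<cdot> \<tau> = \<rho> y \<cdot> \<tau>"
    using Comp_assoc[OF \<tau>(1) \<mu> r\<tau>] \<mu>\<tau> unit_natural[OF \<tau>(1)] by simp
  then have "FAr r \<tau> \<cdot> \<mu> = \<rho> y"
    by (rule epi_cancel[OF \<tau>(2,1) Comp_Hom[OF \<mu> r\<tau>] \<rho>y])
  then have "FAr r \<tau> \<cdot> g \<cdot> \<rho> y = \<iota> (FOb r y) \<cdot> \<rho> y"
    using Comp_assoc[OF \<rho>y g r\<tau>] g\<rho> Idt_Comp[OF \<rho>y] by simp
  then have 2: "FAr r \<tau> \<cdot> g = \<iota> (FOb r y)"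
    by (rule extension_unique[OF FOb_A[OF y] y Comp_Hom[OF g r\<tau>] Idt_Hom[OF HomD(5)[OF \<rho>y]]])
  show ?thesis
    using isomorphismI[OF r\<tau> g 1 2] .
qed

end


section \<open>Extremal subobjects form the smallest intermediate category\<close>

lemma subset_extremal_subobjects:
  assumes "category C" "A \<subseteq> Ob C"
  shows "A \<subseteq> extremal_subobjects C A"
proof
  interpret category C by fact
  fix a
  assume "a \<in> A"
  moreover have "a \<in> Ob C"
    using calculation assms by blast
  moreover have "extremal_mono C (\<iota>\<^bsub>C\<^esub> a)"
    using calculation strong_mono_extremal isomorphism_strong_mono Idt_isomorphism Idt_Hom by blast
  ultimately show "a \<in> extremal_subobjects C A"
    using Idt_Hom by (auto simp: extremal_subobjects_def)
qed

text \<open>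
  An extremal monomorphism from \<open>x\<close> into an object of \<open>A\<close> extends along the reflection of \<open>x\<close> in \<open>B\<close>;
  as the latter is an epimorphism, extremality makes it an isomorphism.
\<close>

lemma extremal_subobjects_subset_epireflective:
  assumes "category C" and t: "epireflector C B t \<tau>" and AB: "A \<subseteq> B"
  shows "extremal_subobjects C A \<subseteq> B"
proof
  interpret reflection C B t \<tau>
    using assms by (simp add: reflection_def reflection_axioms_def epireflector_def)
  fix x
  assume "x \<in> extremal_subobjects C A"
  then obtain a m where x: "x \<in> Ob C" and a: "a \<in> A" and m: "m \<in> Hom C x a" "extremal_mono C m"
    by (auto simp: extremal_subobjects_def)
  have \<tau>: "\<tau> x \<in> Hom C x (FOb t x)" "epi C (\<tau> x)"
    using t unit_Hom[OF x] x by (auto simp: epireflector_def)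
  obtain g where "g \<in> Hom C (FOb t x) a" "g \<cdot>\<^bsub>C\<^esub> \<tau> x = m"
    using extend_along_unit[of a m x] a AB m(1) by blast
  then have "isomorphism C (\<tau> x)"
    using m(2) \<tau> HomD(2,3)[OF m(1)] HomD(5)[OF \<tau>(1)] unfolding extremal_mono_def by metis
  then obtain k where "k \<in> Hom C (FOb t x) x" "isomorphism C k"
    using isomorphism_inverse \<tau>(1) by blast
  moreover have "subcategory C B"
    using refl by (simp add: reflector_def)
  ultimately show "x \<in> B"
    using FOb_A[OF x] HomD(2,3)[of k] unfolding subcategory_def by metis
qed

lemma intermediate_extremal_subobjects:
  assumes "category C" and M: "M_complete C M" and eqs: "has_equalizers C"
    and reg: "\<And>f. regular_mono C f \<Longrightarrow> f \<in> M" and r: "reflector C A r \<rho>"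
  shows "intermediate_category C A r (extremal_subobjects C A)"
proof -
  interpret reflection C A r \<rho>
    using assms by (simp add: reflection_def reflection_axioms_def)
  define B where "B = extremal_subobjects C A"
  have B_Ob: "B \<subseteq> Ob C"
    by (auto simp: B_def extremal_subobjects_def)
  have AB: "A \<subseteq> B"
    unfolding B_def using subset_extremal_subobjects[OF assms(1)] A_Ob by blast
  have B_embed: "\<exists>a \<in> A. \<exists>m \<in> Hom C b a. strong_mono C m" if "b \<in> B" for b
    using that extremal_mono_strong[OF assms(2-4)] unfolding B_def extremal_subobjects_def by blast
  have B_I: "b \<in> B" if "a \<in> A" "m \<in> Hom C b a" "strong_mono C m" for a b m
    using that strong_mono_extremal HomD(4)[OF that(2)] by (auto simp: B_def extremal_subobjects_def)
  have B_sub: "subcategory C B"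
    unfolding subcategory_def
  proof (intro conjI allI impI B_Ob)
    fix f
    assume f: "isomorphism C f \<and> Dom C f \<in> B"
    then obtain a m where am: "a \<in> A" "m \<in> Hom C (Dom C f) a" "strong_mono C m"
      using B_embed by blast
    have "f \<in> Hom C (Dom C f) (Cod C f)"
      using f by (simp add: isomorphism_def Ar_Hom)
    then obtain g where g: "g \<in> Hom C (Cod C f) (Dom C f)" "isomorphism C g"
      using isomorphism_inverse f by blast
    show "Cod C f \<in> B"
      using B_I[OF am(1) Comp_Hom[OF g(1) am(2)]]
        strong_mono_comp[OF isomorphism_strong_mono[OF g(2,1)] g(1) am(3,2)] by blast
  qed

  have "\<exists>z e m. e \<in> Hom C x z \<and> epi C e \<and> m \<in> Hom C z (FOb r x) \<and> strong_mono C m \<and>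
      m \<cdot>\<^bsub>C\<^esub> e = \<rho> x" if "x \<in> Ob C" for x
    using epi_strong_mono_factorization[OF assms(2-4) unit_Hom[OF that]] by metis
  then obtain T \<tau> \<mu> where fact: "\<And>x. x \<in> Ob C \<Longrightarrow> \<tau> x \<in> Hom C x (T x) \<and> epi C (\<tau> x) \<and>
      \<mu> x \<in> Hom C (T x) (FOb r x) \<and> strong_mono C (\<mu> x) \<and> \<mu> x \<cdot>\<^bsub>C\<^esub> \<tau> x = \<rho> x"
    by metis
  then have \<tau>: "\<tau> x \<in> Hom C x (T x)" "epi C (\<tau> x)"
    and \<mu>: "\<mu> x \<in> Hom C (T x) (FOb r x)" "strong_mono C (\<mu> x)" and \<mu>\<tau>: "\<mu> x \<cdot>\<^bsub>C\<^esub> \<tau> x = \<rho> x"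
    if "x \<in> Ob C" for x
    using that by blast+

  have T_B: "T x \<in> B" if "x \<in> Ob C" for x
    using B_I[OF FOb_A[OF that] \<mu>[OF that]] .
  have \<tau>_universal: "\<exists>!g. g \<in> Hom C (T x) b \<and> g \<cdot>\<^bsub>C\<^esub> \<tau> x = f"
    if b: "b \<in> B" and f: "f \<in> Hom C x b" for x b f
  proof -
    have x: "x \<in> Ob C"
      using HomD(4)[OF f] .
    obtain a n where a: "a \<in> A" and n: "n \<in> Hom C b a" "strong_mono C n"
      using B_embed[OF b] by blast
    obtain h where h: "h \<in> Hom C (FOb r x) a" and h\<rho>: "h \<cdot>\<^bsub>C\<^esub> \<rho> x = n \<cdot>\<^bsub>C\<^esub> f"
      using extend_along_unit[OF a Comp_Hom[OF f n(1)]] by blast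
    \<comment> \<open>The reflection of \<open>f\<close> is the diagonal of the square \<open>n \<cdot> f = (h \<cdot> \<mu> x) \<cdot> \<tau> x\<close>.\<close>
    have "n \<cdot>\<^bsub>C\<^esub> f = h \<cdot>\<^bsub>C\<^esub> \<mu> x \<cdot>\<^bsub>C\<^esub> \<tau> x"
      using Comp_assoc[OF \<tau>(1)[OF x] \<mu>(1)[OF x] h] h\<rho> \<mu>\<tau>[OF x] by simp
    then obtain d where "d \<in> Hom C (T x) b" "d \<cdot>\<^bsub>C\<^esub> \<tau> x = f"
      using strong_mono_diagonal[OF n(2,1) \<tau>(2)[OF x] \<tau>(1)[OF x] f Comp_Hom[OF \<mu>(1)[OF x] h]] by blast
    then show ?thesis
      using epi_cancel[OF \<tau>(2)[OF x] \<tau>(1)[OF x]] by blast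
  qed
  obtain t where t: "reflector C B t \<tau>" and tT: "FOb t = T"
    using reflector_of_universal_arrows[OF assms(1) B_sub T_B \<tau>(1) \<tau>_universal] by blast
  have t_epi: "epireflector C B t \<tau>"
    using t \<tau>(2) by (simp add: epireflector_def)

  have s_epi: "epireflector (full_sub C B) A r \<rho>"
    unfolding epireflector_def
  proof (intro conjI ballI)
    show "reflector (full_sub C B) A r \<rho>"
      using reflector_restrict[OF r AB B_Ob] .
    fix x
    assume "x \<in> Ob (full_sub C B)"
    then have xB: "x \<in> B" and x: "x \<in> Ob C"
      using B_Ob by auto
    have "f = g" if b: "b \<in> B" and f: "f \<in> Hom C (FOb r x) b" and g: "g \<in> Hom C (FOb r x) b"
      and fg: "f \<cdot>\<^bsub>C\<^esub> \<rho> x = g \<cdot>\<^bsub>C\<^esub> \<rho> x" for b f g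
    proof -
      obtain a n where a: "a \<in> A" and n: "n \<in> Hom C b a" "strong_mono C n"
        using B_embed[OF b] by blast
      have "n \<cdot>\<^bsub>C\<^esub> f \<cdot>\<^bsub>C\<^esub> \<rho> x = n \<cdot>\<^bsub>C\<^esub> g \<cdot>\<^bsub>C\<^esub> \<rho> x"
        using Comp_assoc[OF unit_Hom[OF x] f n(1)] Comp_assoc[OF unit_Hom[OF x] g n(1)] fg by simp
      then have "n \<cdot>\<^bsub>C\<^esub> f = n \<cdot>\<^bsub>C\<^esub> g"
        using extension_unique[OF a x Comp_Hom[OF f n(1)] Comp_Hom[OF g n(1)]] by blast
      then show ?thesis
        using monic_cancel[OF _ n(1) f g] n(2) by (simp add: strong_mono_def)
    qed
    then show "epi (full_sub C B) (\<rho> x)"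
      using HomD[OF unit_Hom[OF x]] xB FOb_A[OF x] AB
      by (auto simp: epi_def Hom_full_sub Ar_full_sub)
  qed

  \<comment> \<open>The isomorphism from \<open>r x\<close> to \<open>r (t x)\<close> is \<open>r\<close> applied to the epimorphic part of \<open>\<rho> x\<close>.\<close>
  have "naturally_isomorphic C (full_sub C A) r (comp_func r t)"
    unfolding naturally_isomorphic_def
  proof (intro exI[of _ "\<lambda>x. FAr r (\<tau> x)"] conjI ballI)
    fix x
    assume x: "x \<in> Ob C"
    have r\<tau>: "FAr r (\<tau> x) \<in> Hom C (FOb r x) (FOb r (T x))"
      using FAr_Hom[OF \<tau>(1)[OF x]] .
    have rA: "FOb r x \<in> A" "FOb r (T x) \<in> A"
      using FOb_A x HomD(5)[OF \<tau>(1)[OF x]] by blast+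
    show "FAr r (\<tau> x) \<in> Hom (full_sub C A) (FOb r x) (FOb (comp_func r t) x)"
      using r\<tau> rA by (simp add: Hom_full_sub comp_func_def tT)
    show "isomorphism (full_sub C A) (FAr r (\<tau> x))"
      using FAr_epi_factor_isomorphism[OF \<tau>(1)[OF x] \<tau>(2)[OF x] \<mu>(1)[OF x] \<mu>\<tau>[OF x]] HomD[OF r\<tau>] rA
      by (simp add: isomorphism_full_sub)
  next
    interpret T: reflection C B t \<tau>
      using assms(1) t by (simp add: reflection_def reflection_axioms_def)
    fix f
    assume "f \<in> Ar C"
    then have f: "f \<in> Hom C (Dom C f) (Cod C f)" and x: "Dom C f \<in> Ob C" and y: "Cod C f \<in> Ob C"
      using Ar_Hom Dom_Ob Cod_Ob by blast+
    show "FAr r (\<tau> (Cod C f)) \<cdot>\<^bsub>full_sub C A\<^esub> FAr r f = FAr (comp_func r t) f \<cdot>\<^bsub>full_sub C A\<^esub> FAr r (\<tau> (Dom C f))"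
      using FAr_Comp[OF f \<tau>(1)[OF y]] FAr_Comp[OF T.unit_Hom[OF x] T.FAr_Hom[OF f]] T.unit_natural[OF f]
      by (simp add: comp_func_def)
  qed
  then show ?thesis
    using t_epi s_epi unfolding intermediate_category_def B_def by blast
qed


section \<open>Regular closure operators\<close>

text \<open>Since \<open>n\<close> is monic, \<open>h\<close> and \<open>k\<close> agree on exactly the same morphisms as \<open>n \<cdot> h\<close> and \<open>n \<cdot> k\<close>.\<close>

lemma (in category) equalizer_comp_monic:
  assumes eq: "equalizer C h k e" and n: "monic C n" "n \<in> Hom C (Cod C h) a"
  shows "equalizer C (n \<cdot> h) (n \<cdot> k) e"
proof -
  have h: "h \<in> Hom C (Dom C h) (Cod C h)" and k: "k \<in> Hom C (Dom C h) (Cod C h)"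
    and e: "e \<in> Hom C (Dom C e) (Dom C h)" and he: "h \<cdot> e = k \<cdot> e"
    using eq by (auto simp: equalizer_def Hom_def)
  have nh: "n \<cdot> h \<in> Hom C (Dom C h) a" and nk: "n \<cdot> k \<in> Hom C (Dom C h) a"
    using Comp_Hom h k n by blast+
  have "n \<cdot> h \<cdot> e = n \<cdot> k \<cdot> e"
    using Comp_assoc[OF e h n(2)] Comp_assoc[OF e k n(2)] he by simp
  moreover have "h \<cdot> f = k \<cdot> f" if f: "f \<in> Hom C z (Dom C h)" and eqf: "n \<cdot> h \<cdot> f = n \<cdot> k \<cdot> f" for z f
    using monic_cancel[OF n Comp_Hom[OF f h] Comp_Hom[OF f k]]
      Comp_assoc[OF f h n(2)] Comp_assoc[OF f k n(2)] eqf by simp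
  ultimately show ?thesis
    using eq HomD(1-3)[OF nh] nk HomD(1,3)[OF e] by (simp add: equalizer_def)
qed

lemma regular_mono_wrt_extremal_subobjects:
  assumes "category C" "A \<subseteq> Ob C"
  shows "regular_mono_wrt C (extremal_subobjects C A) = regular_mono_wrt C A"
proof
  interpret category C by fact
  fix e
  show "regular_mono_wrt C (extremal_subobjects C A) e = regular_mono_wrt C A e"
  proof
    assume "regular_mono_wrt C (extremal_subobjects C A) e"
    then obtain h k a n where eq: "equalizer C h k e" and a: "a \<in> A"
      and n: "n \<in> Hom C (Cod C h) a" "monic C n"
      by (auto simp: regular_mono_wrt_def extremal_subobjects_def extremal_mono_def)
    have "h \<in> Hom C (Dom C h) (Cod C h)"
      using eq by (simp add: equalizer_def Ar_Hom)
    then have "Cod C (n \<cdot>\<^bsub>C\<^esub> h) = a"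
      using HomD(3) Comp_Hom n(1) by blast
    then show "regular_mono_wrt C A e"
      using equalizer_comp_monic[OF eq n(2,1)] a by (auto simp: regular_mono_wrt_def)
  next
    assume "regular_mono_wrt C A e"
    then show "regular_mono_wrt C (extremal_subobjects C A) e"
      using subset_extremal_subobjects[OF assms] by (auto simp: regular_mono_wrt_def)
  qed
qed

theorem theorem3p3:
  fixes X :: "('o, 'a) category" and M :: "'a set" and U :: "'u set"
    and A :: "'o set" and r :: "('o, 'a, 'o, 'a) func" and \<rho> :: "'o \<Rightarrow> 'a"
  assumes "category X"
    and "M_complete X M"
    and "has_equalizers X"
    and "has_cokernel_pairs X"
    and "\<And>f. regular_mono X f \<Longrightarrow> f \<in> M"
    and "wellpowered U X"
    and "has_intersections U X"
    and "reflector X A r \<rho>"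
  shows "smallest_intermediate_category X A r (extremal_subobjects X A) \<and>
    (\<forall>m \<in> M. sub_equiv X (regular_closure X M A m)
                         (regular_closure X M (extremal_subobjects X A) m))"
proof (intro conjI ballI)
  have "extremal_subobjects X A \<subseteq> B" if B: "intermediate_category X A r B" for B
  proof -
    obtain t \<tau> s \<sigma> where t: "epireflector X B t \<tau>" and s: "epireflector (full_sub X B) A s \<sigma>"
      using B unfolding intermediate_category_def by blast
    have "A \<subseteq> B"
      using s by (simp add: epireflector_def reflector_def subcategory_def)
    then show ?thesis
      using extremal_subobjects_subset_epireflective[OF assms(1) t] by blast
  qed
  then show "smallest_intermediate_category X A r (extremal_subobjects X A)"
    using intermediate_extremal_subobjects[OF assms(1-3,5,8)]
    by (simp add: smallest_intermediate_category_def)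
next
  interpret category X by fact
  fix m
  assume m: "m \<in> M"
  define c where "c = regular_closure X M A m"
  have "A \<subseteq> Ob X"
    using assms(8) by (simp add: reflector_def subcategory_def)
  then have same: "regular_closure X M (extremal_subobjects X A) m = c"
    using regular_mono_wrt_extremal_subobjects[OF assms(1)] by (simp add: regular_closure_def c_def)
  have "c \<in> M"
    using regular_closure_is_meet[OF assms(1,2) m] by (auto simp: c_def is_meet_def M_over_def)
  then have c: "c \<in> Hom X (Dom X c) (Cod X c)"
    using assms(2) by (auto simp: M_complete_def Hom_def)
  then have "sub_le X c c"
    using Idt_Hom[OF HomD(4)[OF c]] Comp_Idt[OF c] HomD(1)[OF c] unfolding sub_le_def by metis
  then show "sub_equiv X (regular_closure X M A m) (regular_closure X M (extremal_subobjects X A) m)"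
    using same by (simp add: sub_equiv_def c_def)
qed

end
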